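(* Let $\Omega$ be either an open connected subset of $\mathbb{R}^2$ with Lipschitz boundary or the torus $\mathbb{T}^2$ with side lengths $L_x,L_y$. For any functions $\eta,\nabla h\in L^\infty(\Omega)$ with $\eta_{\min}>0$, the quantity $\kappa_{\rm ub}$ satisfies $$\gamma^\star_{\rm P}\ \le\ \kappa_{\rm ub}\ \le\ \left(\frac{4+\sqrt{13}}{4-\sqrt{13}}\right)\gamma^\star_{\rm P},$$ where $\gamma^\star_{\rm P}$ is the optimal value of the following problem (P) over $(\sigma,\alpha,\gamma)\in\mathbb{R}^3$: minimize $\gamma$ subject to $$\boldsymbol{M}(\boldsymbol{x})\preceq\begin{pmatrix}\sigma\boldsymbol{I}&0\\0&\alpha\end{pmatrix}\preceq\gamma\,\boldsymbol{M}(\boldsymbol{x})\qquad\text{for (almost every) }\boldsymbol{x}\in\Omega.$$ In the case of a flat bathymetry ($\nabla h=0$), $\kappa_{\rm ub}=\gamma^\star_{\rm P}$.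
   Context: Here $\eta,h:\Omega\to\mathbb{R}$ are real-valued, $\boldsymbol{I}$ is the $2\times2$ identity matrix, and for symmetric matrices $\boldsymbol{X}\preceq\boldsymbol{Y}$ means $\boldsymbol{Y}-\boldsymbol{X}$ is positive semidefinite. Notation: $|\nabla h|_{\max}=\max_{\boldsymbol{x}\in\Omega}|\nabla h(\boldsymbol{x})|$, $\eta_{\min}=\min_{\boldsymbol{x}\in\Omega}\eta(\boldsymbol{x})$, $\eta_{\max}=\max_{\boldsymbol{x}\in\Omega}\eta(\boldsymbol{x})$; all maxima and minima over $\boldsymbol{x}$ are understood as essential suprema and infima. $\boldsymbol{M}(\boldsymbol{x})$ is the symmetric $3\times3$ matrix (in block form, with $\nabla h$ a column vector in $\mathbb{R}^2$) $$\boldsymbol{M}(\boldsymbol{x})=\eta(\boldsymbol{x})\begin{pmatrix}\boldsymbol{I}+\nabla h(\boldsymbol{x})\nabla h(\boldsymbol{x})^T&\tfrac12\eta(\boldsymbol{x})\nabla h(\boldsymbol{x})\\ \tfrac12\eta(\boldsymbol{x})\nabla h(\boldsymbol{x})^T&\tfrac13\eta(\boldsymbol{x})^2\end{pmatrix}.$$ The quantity $\kappa_{\rm ub}$ is defined as follows. If $|\nabla h|_{\max}=0$, then $\kappa_{\rm ub}=(\eta_{\max}/\eta_{\min})^3$. If $|\nabla h|_{\max}\ne0$, then $$\kappa_{\rm ub}=\max\left\{\frac{\sigma^\star}{\eta_{\min}},\ \left(\frac{4+\sqrt{13}}{4-\sqrt{13}}\right)\left(\frac{\eta_{\max}}{\eta_{\min}}\right)^3\right\},\qquad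 \sigma^\star=\max_{\boldsymbol{x}\in\Omega}\left(\eta(\boldsymbol{x})+\tfrac16(4+\sqrt{13})\,\eta(\boldsymbol{x})|\nabla h(\boldsymbol{x})|^2\right).$$ *)

theory Defs
  imports "HOL-Analysis.Analysis" "HOL-Probability.Essential_Supremum"
begin

text \<open>
  Near each boundary point, in suitably rotated (or reflected) coordinates, the set is the strict
  epigraph of a Lipschitz function. The set need not be bounded, and the Lipschitz constant may
  depend on the boundary point.
\<close>

definition lipschitz_boundary :: "(real^2) set \<Rightarrow> bool" where
  "lipschitz_boundary U \<longleftrightarrow>
     (\<forall>p \<in> frontier U. \<exists>r > 0. \<exists>T :: real^2 \<Rightarrow> real^2. \<exists>\<phi> :: real \<Rightarrow> real. \<exists>L.
        orthogonal_transformation T \<and> L-lipschitz_on UNIV \<phi> \<and>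
        (\<forall>y \<in> ball p r. y \<in> U \<longleftrightarrow> \<phi> (T y $ 1) < T y $ 2))"

text \<open>
  A function on the torus with side lengths \<open>Lx\<close> and \<open>Ly\<close> is represented by its doubly periodic
  lift to the plane; integrals and null sets refer to the fundamental cell. A function on a planar
  set is a total function on the plane whose values outside the set are irrelevant.
\<close>

datatype dom = Planar "(real^2) set" | Torus real real

fun admissible_dom :: "dom \<Rightarrow> bool" where
  "admissible_dom (Planar U) \<longleftrightarrow> open U \<and> connected U \<and> U \<noteq> {} \<and> lipschitz_boundary U"
| "admissible_dom (Torus Lx Ly) \<longleftrightarrow> 0 < Lx \<and> 0 < Ly"

fun region :: "dom \<Rightarrow> (real^2) set" where
  "region (Planar U) = U"
| "region (Torus Lx Ly) = {x. 0 \<le> x $ 1 \<and> x $ 1 < Lx \<and> 0 \<le> x $ 2 \<and> x $ 2 < Ly}"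

abbreviation dom_measure :: "dom \<Rightarrow> (real^2) measure" where
  "dom_measure \<Omega> \<equiv> lebesgue_on (region \<Omega>)"

fun function_on_dom :: "dom \<Rightarrow> (real^2 \<Rightarrow> 'b) \<Rightarrow> bool" where
  "function_on_dom (Planar U) f \<longleftrightarrow> True"
| "function_on_dom (Torus Lx Ly) f \<longleftrightarrow>
     (\<forall>x. f (x + axis 1 Lx) = f x \<and> f (x + axis 2 Ly) = f x)"

definition L_infinity :: "dom \<Rightarrow> (real^2 \<Rightarrow> 'b::euclidean_space) set" where
  "L_infinity \<Omega> = {f. function_on_dom \<Omega> f \<and> f \<in> borel_measurable (dom_measure \<Omega>) \<and>
     (\<exists>C. AE x in dom_measure \<Omega>. norm (f x) \<le> C)}"

text \<open>
  Real-valued versions, used below only for functions that are essentially bounded (on a domain of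
  positive measure), where the extended real values are finite.
\<close>

definition ess_max :: "dom \<Rightarrow> (real^2 \<Rightarrow> real) \<Rightarrow> real" where
  "ess_max \<Omega> f = real_of_ereal (esssup (dom_measure \<Omega>) (\<lambda>x. ereal (f x)))"

definition ess_min :: "dom \<Rightarrow> (real^2 \<Rightarrow> real) \<Rightarrow> real" where
  "ess_min \<Omega> f = - ess_max \<Omega> (\<lambda>x. - f x)"

coinductive smooth :: "(real^2 \<Rightarrow> real) \<Rightarrow> bool" where
  "(\<And>x. f differentiable (at x)) \<Longrightarrow> (\<And>v. smooth (\<lambda>x. frechet_derivative f (at x) v)) \<Longrightarrow> smooth f"

fun test_function :: "dom \<Rightarrow> (real^2 \<Rightarrow> real) \<Rightarrow> bool" where
  "test_function (Planar U) \<phi> \<longleftrightarrow>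
     smooth \<phi> \<and> (\<exists>K. compact K \<and> K \<subseteq> U \<and> (\<forall>x. x \<notin> K \<longrightarrow> \<phi> x = 0))"
| "test_function (Torus Lx Ly) \<phi> \<longleftrightarrow> smooth \<phi> \<and> function_on_dom (Torus Lx Ly) \<phi>"

fun locally_integrable :: "dom \<Rightarrow> (real^2 \<Rightarrow> real) \<Rightarrow> bool" where
  "locally_integrable (Planar U) f \<longleftrightarrow>
     (\<forall>K. compact K \<and> K \<subseteq> U \<longrightarrow> integrable (lebesgue_on K) f)"
| "locally_integrable (Torus Lx Ly) f \<longleftrightarrow> integrable (dom_measure (Torus Lx Ly)) f"

definition has_weak_gradient :: "dom \<Rightarrow> (real^2 \<Rightarrow> real) \<Rightarrow> (real^2 \<Rightarrow> real^2) \<Rightarrow> bool" where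
  "has_weak_gradient \<Omega> h g \<longleftrightarrow>
     function_on_dom \<Omega> h \<and> locally_integrable \<Omega> h \<and>
     function_on_dom \<Omega> g \<and> (\<forall>i. locally_integrable \<Omega> (\<lambda>x. g x $ i)) \<and>
     (\<forall>\<phi> i. test_function \<Omega> \<phi> \<longrightarrow>
        integral\<^sup>L (dom_measure \<Omega>) (\<lambda>x. h x * frechet_derivative \<phi> (at x) (axis i 1))
          = - integral\<^sup>L (dom_measure \<Omega>) (\<lambda>x. g x $ i * \<phi> x))"

definition pos_semidef :: "real^'n^'n \<Rightarrow> bool" where
  "pos_semidef A \<longleftrightarrow> transpose A = A \<and> (\<forall>v. 0 \<le> v \<bullet> (A *v v))"

definition loewner_le :: "real^'n^'n \<Rightarrow> real^'n^'n \<Rightarrow> bool" (infix "\<preceq>" 50) where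
  "X \<preceq> Y \<longleftrightarrow> pos_semidef (Y - X)"

text \<open>The symmetric block matrix with diagonal blocks \<open>A\<close>, \<open>c\<close> and off-diagonal column \<open>b\<close>.\<close>

definition sym_block :: "real^2^2 \<Rightarrow> real^2 \<Rightarrow> real \<Rightarrow> real^3^3" where
  "sym_block A b c = vector
     [vector [A $ 1 $ 1, A $ 1 $ 2, b $ 1],
      vector [A $ 2 $ 1, A $ 2 $ 2, b $ 2],
      vector [b $ 1,     b $ 2,     c    ]]"

text \<open>The arguments \<open>e\<close> and \<open>g\<close> are the values of \<open>\<eta>\<close> and of the gradient of \<open>h\<close> at a point.\<close>

definition M_matrix :: "real \<Rightarrow> real^2 \<Rightarrow> real^3^3" where
  "M_matrix e g = e *\<^sub>R sym_block
     (mat 1 + (columnvector g :: real^1^2) ** (rowvector g :: real^2^1))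
     ((e / 2) *\<^sub>R g)
     (e\<^sup>2 / 3)"

definition D_matrix :: "real \<Rightarrow> real \<Rightarrow> real^3^3" where
  "D_matrix \<sigma> \<alpha> = sym_block (\<sigma> *\<^sub>R mat 1) 0 \<alpha>"

definition feasible_P ::
  "dom \<Rightarrow> (real^2 \<Rightarrow> real) \<Rightarrow> (real^2 \<Rightarrow> real^2) \<Rightarrow> (real \<times> real \<times> real) set" where
  "feasible_P \<Omega> \<eta> g = {(\<sigma>, \<alpha>, \<gamma>). AE x in dom_measure \<Omega>.
     M_matrix (\<eta> x) (g x) \<preceq> D_matrix \<sigma> \<alpha> \<and> D_matrix \<sigma> \<alpha> \<preceq> \<gamma> *\<^sub>R M_matrix (\<eta> x) (g x)}"

text \<open>Extended-real-valued, so that an infeasible problem has optimal value \<open>\<infinity>\<close>.\<close>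

definition gamma_P :: "dom \<Rightarrow> (real^2 \<Rightarrow> real) \<Rightarrow> (real^2 \<Rightarrow> real^2) \<Rightarrow> ereal" where
  "gamma_P \<Omega> \<eta> g = (INF (\<sigma>, \<alpha>, \<gamma>) \<in> feasible_P \<Omega> \<eta> g. ereal \<gamma>)"

definition sigma_star :: "dom \<Rightarrow> (real^2 \<Rightarrow> real) \<Rightarrow> (real^2 \<Rightarrow> real^2) \<Rightarrow> real" where
  "sigma_star \<Omega> \<eta> g =
     ess_max \<Omega> (\<lambda>x. \<eta> x + 1 / 6 * (4 + sqrt 13) * \<eta> x * (norm (g x))\<^sup>2)"

definition kappa_ub :: "dom \<Rightarrow> (real^2 \<Rightarrow> real) \<Rightarrow> (real^2 \<Rightarrow> real^2) \<Rightarrow> real" where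
  "kappa_ub \<Omega> \<eta> g =
     (if ess_max \<Omega> (\<lambda>x. norm (g x)) = 0
      then (ess_max \<Omega> \<eta> / ess_min \<Omega> \<eta>) ^ 3
      else max (sigma_star \<Omega> \<eta> g / ess_min \<Omega> \<eta>)
               ((4 + sqrt 13) / (4 - sqrt 13) * (ess_max \<Omega> \<eta> / ess_min \<Omega> \<eta>) ^ 3))"

end

theory Submission
  imports Defs
begin

text \<open>
  At a point with depth \<open>e > 0\<close> and gradient \<open>g\<close>, the quadratic form of the matrix \<open>M\<close> at
  \<open>(u, w)\<close> is \<open>e\<close> times \<open>|u|\<^sup>2 + (s\<^sup>2 + s t + t\<^sup>2/3)\<close> with \<open>s = g \<bullet> u\<close> and \<open>t = e w\<close>. The binary
  form in \<open>s\<close> and \<open>t\<close> has the eigenvalues \<open>(4 + sqrt 13)/6\<close> and \<open>(4 - sqrt 13)/6\<close>. Replacing it by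
  the larger eigenvalue times \<open>s\<^sup>2 + t\<^sup>2\<close>, with \<open>s\<^sup>2 \<le> |g|\<^sup>2 |u|\<^sup>2\<close>, or by the smaller eigenvalue times
  \<open>t\<^sup>2\<close> gives diagonal matrices above and below \<open>M\<close>
  (\<open>M_form_upper\<close>, \<open>M_form_lower\<close>). Optimising over \<open>x\<close> in these
  bounds gives a feasible point of (P) whose value is \<open>kappa_ub\<close>; for \<open>g = 0\<close> the form is already
  diagonal, with entry \<open>e^3 / 3\<close> in place of both eigenvalue bounds (\<open>kappa_ub_feasible\<close>).

  Conversely, in any feasible triple, testing the two matrix inequalities on \<open>u = g\<close>, on \<open>u\<close>
  orthogonal to \<open>g\<close> and on \<open>u = 0\<close> gives \<open>\<eta> (1 + |g|\<^sup>2) \<le> \<sigma> \<le> \<gamma> \<eta>\<close> and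
  \<open>\<eta>^3 / 3 \<le> \<alpha> \<le> \<gamma> \<eta>^3 / 3\<close> almost everywhere. Comparing the largest left-hand side with the
  smallest right-hand side bounds \<open>\<gamma>\<close> from below (\<open>feasible_lower_bounds\<close>). Each term of
  \<open>kappa_ub\<close> exceeds the corresponding lower bound at most by the ratio of the two eigenvalues, and
  agrees with it when \<open>g = 0\<close>.
\<close>

section \<open>The quadratic forms of the matrices\<close>

definition M_form :: "real \<Rightarrow> real^2 \<Rightarrow> real^2 \<Rightarrow> real \<Rightarrow> real" where
  "M_form e g u w = e * ((norm u)\<^sup>2 + (g \<bullet> u)\<^sup>2 + e * (g \<bullet> u) * w + e\<^sup>2 * w\<^sup>2 / 3)"

lemma power2_norm_vec2: "(norm u)\<^sup>2 = (u $ 1)\<^sup>2 + (u $ 2)\<^sup>2" for u :: "real^2"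
  by (simp only: dot_square_norm[symmetric]) (simp add: inner_vec_def sum_2 power2_eq_square)

lemma inner_vec2: "g \<bullet> u = g $ 1 * u $ 1 + g $ 2 * u $ 2" for u :: "real^2"
  by (simp add: inner_vec_def sum_2)

lemma M_matrix_form:
  "z \<bullet> (M_matrix e g *v z) = M_form e g (vector [z $ 1, z $ 2]) (z $ 3)"
  unfolding M_form_def power2_norm_vec2 inner_vec2
  by (simp add: M_matrix_def sym_block_def inner_vec_def matrix_vector_mult_def sum_3
      vector_3 matrix_matrix_mult_def columnvector_def rowvector_def mat_def algebra_simps power2_eq_square add_divide_distrib)

lemma D_matrix_form:
  "z \<bullet> (D_matrix \<sigma> \<alpha> *v z) = \<sigma> * (norm (vector [z $ 1, z $ 2] :: real^2))\<^sup>2 + \<alpha> * (z $ 3)\<^sup>2"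
  unfolding power2_norm_vec2
  by (simp add: D_matrix_def sym_block_def inner_vec_def matrix_vector_mult_def sum_3 vector_3 mat_def algebra_simps power2_eq_square)

lemma transpose_M_matrix: "transpose (M_matrix e g) = M_matrix e g"
  by (simp add: M_matrix_def sym_block_def vec_eq_iff transpose_def forall_3 vector_3
      matrix_matrix_mult_def columnvector_def rowvector_def mat_def)

lemma transpose_D_matrix: "transpose (D_matrix \<sigma> \<alpha>) = D_matrix \<sigma> \<alpha>"
  by (simp add: D_matrix_def sym_block_def vec_eq_iff transpose_def forall_3 vector_3 mat_def)

lemma loewner_le_iff:
  assumes "transpose X = X" "transpose Y = Y"
  shows "X \<preceq> Y \<longleftrightarrow> (\<forall>v. v \<bullet> (X *v v) \<le> v \<bullet> (Y *v v))"
  using assms unfolding loewner_le_def pos_semidef_def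
  by (simp add: matrix_vector_mult_diff_rdistrib inner_diff_right)
     (simp add: transpose_def vec_eq_iff)

lemma all_vec3_split:
  "(\<forall>z :: real^3. P (vector [z $ 1, z $ 2] :: real^2) (z $ 3)) \<longleftrightarrow> (\<forall>u w. P u w)"
proof (intro iffI allI)
  fix u :: "real^2" and w :: real
  assume "\<forall>z :: real^3. P (vector [z $ 1, z $ 2] :: real^2) (z $ 3)"
  then have "P (vector [(vector [u $ 1, u $ 2, w] :: real^3) $ 1, (vector [u $ 1, u $ 2, w] :: real^3) $ 2])
               ((vector [u $ 1, u $ 2, w] :: real^3) $ 3)"
    by blast
  moreover have "vector [u $ 1, u $ 2] = u"
    by (simp add: vec_eq_iff forall_2)
  ultimately show "P u w"
    by (simp add: vector_3)
qed simp

lemma M_le_D_iff: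
  "M_matrix e g \<preceq> D_matrix \<sigma> \<alpha> \<longleftrightarrow> (\<forall>u w. M_form e g u w \<le> \<sigma> * (norm u)\<^sup>2 + \<alpha> * w\<^sup>2)"
  by (simp add: loewner_le_iff transpose_M_matrix transpose_D_matrix M_matrix_form D_matrix_form
      all_vec3_split[of "\<lambda>u w. M_form e g u w \<le> \<sigma> * (norm u)\<^sup>2 + \<alpha> * w\<^sup>2"])

lemma D_le_M_iff:
  "D_matrix \<sigma> \<alpha> \<preceq> \<gamma> *\<^sub>R M_matrix e g \<longleftrightarrow>
     (\<forall>u w. \<sigma> * (norm u)\<^sup>2 + \<alpha> * w\<^sup>2 \<le> \<gamma> * M_form e g u w)"
proof -
  have "transpose (\<gamma> *\<^sub>R M_matrix e g) = \<gamma> *\<^sub>R M_matrix e g"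
    using transpose_M_matrix[of e g] by (simp add: transpose_def vec_eq_iff)
  then show ?thesis
    by (simp add: loewner_le_iff transpose_D_matrix M_matrix_form D_matrix_form
        scaleR_matrix_vector_assoc[symmetric]
        all_vec3_split[of "\<lambda>u w. \<sigma> * (norm u)\<^sup>2 + \<alpha> * w\<^sup>2 \<le> \<gamma> * M_form e g u w"])
qed

section \<open>Pointwise bounds\<close>

lemma sqrt13_bounds: "7 / 2 < sqrt 13" "sqrt 13 < 4"
  by (rule real_less_rsqrt, simp add: power2_eq_square, rule real_less_lsqrt, auto)

text \<open>
  The extreme eigenvalues of the symmetric matrix with rows \<open>(1, 1/2)\<close> and \<open>(1/2, 1/3)\<close>. The
  difference of the two sides has rank one, so it is a nonnegative multiple of a perfect square.
\<close>

lemma binary_form_upper: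
  fixes s t :: real
  shows "s\<^sup>2 + s * t + t\<^sup>2 / 3 \<le> (4 + sqrt 13) / 6 * (s\<^sup>2 + t\<^sup>2)"
proof -
  define r where "r = sqrt 13"
  have r: "r * r = 13" "2 < r"
    using sqrt13_bounds by (auto simp: r_def)
  have "9 * (4 + r) * (s\<^sup>2 + t\<^sup>2) - 54 * (s\<^sup>2 + s * t) - 18 * t\<^sup>2 = (r - 2) * (3 * s - (r + 2) * t)\<^sup>2"
  proof -
    have "(r - 2) * (3 * s - (r + 2) * t)\<^sup>2
        = 9 * (r - 2) * s\<^sup>2 - 6 * (r * r - 4) * s * t + (r * r - 4) * (r + 2) * t\<^sup>2"
      by (simp add: algebra_simps power2_eq_square)
    then show ?thesis
      unfolding r(1) by (simp add: algebra_simps)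
  qed
  moreover have "0 \<le> (r - 2) * (3 * s - (r + 2) * t)\<^sup>2"
    using r(2) by simp
  ultimately show ?thesis
    by (simp add: r_def[symmetric] algebra_simps)
qed

lemma binary_form_lower:
  fixes s t :: real
  shows "(4 - sqrt 13) / 6 * (s\<^sup>2 + t\<^sup>2) \<le> s\<^sup>2 + s * t + t\<^sup>2 / 3"
proof -
  define r where "r = sqrt 13"
  have r: "r * r = 13" "2 < r"
    using sqrt13_bounds by (auto simp: r_def)
  have "54 * (s\<^sup>2 + s * t) + 18 * t\<^sup>2 - 9 * (4 - r) * (s\<^sup>2 + t\<^sup>2) = (r + 2) * (3 * s + (r - 2) * t)\<^sup>2"
  proof -
    have "(r + 2) * (3 * s + (r - 2) * t)\<^sup>2
        = 9 * (r + 2) * s\<^sup>2 + 6 * (r * r - 4) * s * t + (r * r - 4) * (r - 2) * t\<^sup>2"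
      by (simp add: algebra_simps power2_eq_square)
    then show ?thesis
      unfolding r(1) by (simp add: algebra_simps)
  qed
  moreover have "0 \<le> (r + 2) * (3 * s + (r - 2) * t)\<^sup>2"
    using r(2) by simp
  ultimately show ?thesis
    by (simp add: r_def[symmetric] algebra_simps)
qed

lemma M_form_upper:
  assumes "0 < e"
  shows "M_form e g u w \<le> (e + 1 / 6 * (4 + sqrt 13) * e * (norm g)\<^sup>2) * (norm u)\<^sup>2
           + (4 + sqrt 13) / 6 * e ^ 3 * w\<^sup>2"
proof -
  have cs: "(g \<bullet> u)\<^sup>2 \<le> (norm g)\<^sup>2 * (norm u)\<^sup>2"
    using Cauchy_Schwarz_ineq[of g u] by (simp add: dot_square_norm)
  have "(g \<bullet> u)\<^sup>2 + e * (g \<bullet> u) * w + e\<^sup>2 * w\<^sup>2 / 3 \<le> (4 + sqrt 13) / 6 * ((g \<bullet> u)\<^sup>2 + (e * w)\<^sup>2)"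
    using binary_form_upper[of "g \<bullet> u" "e * w"] by (simp add: power_mult_distrib mult_ac)
  also have "\<dots> \<le> (4 + sqrt 13) / 6 * ((norm g)\<^sup>2 * (norm u)\<^sup>2 + (e * w)\<^sup>2)"
    using cs by (intro mult_left_mono add_right_mono) auto
  finally have "e * ((norm u)\<^sup>2 + ((g \<bullet> u)\<^sup>2 + e * (g \<bullet> u) * w + e\<^sup>2 * w\<^sup>2 / 3))
      \<le> e * ((norm u)\<^sup>2 + (4 + sqrt 13) / 6 * ((norm g)\<^sup>2 * (norm u)\<^sup>2 + (e * w)\<^sup>2))"
    using assms by (intro mult_left_mono add_left_mono) auto
  also have "\<dots> = (e + 1 / 6 * (4 + sqrt 13) * e * (norm g)\<^sup>2) * (norm u)\<^sup>2
           + (4 + sqrt 13) / 6 * e ^ 3 * w\<^sup>2"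
    by (simp add: field_simps power2_eq_square power3_eq_cube)
  finally show ?thesis
    by (simp add: M_form_def add.assoc)
qed

lemma M_form_lower:
  assumes "0 < e"
  shows "e * (norm u)\<^sup>2 + (4 - sqrt 13) / 6 * e ^ 3 * w\<^sup>2 \<le> M_form e g u w"
proof -
  have "(4 - sqrt 13) / 6 * (e * w)\<^sup>2 \<le> (4 - sqrt 13) / 6 * ((g \<bullet> u)\<^sup>2 + (e * w)\<^sup>2)"
    using sqrt13_bounds by (intro mult_left_mono) auto
  also have "\<dots> \<le> (g \<bullet> u)\<^sup>2 + e * (g \<bullet> u) * w + e\<^sup>2 * w\<^sup>2 / 3"
    using binary_form_lower[of "g \<bullet> u" "e * w"] by (simp add: power_mult_distrib mult_ac)
  finally have "e * ((norm u)\<^sup>2 + (4 - sqrt 13) / 6 * (e * w)\<^sup>2)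
      \<le> e * ((norm u)\<^sup>2 + ((g \<bullet> u)\<^sup>2 + e * (g \<bullet> u) * w + e\<^sup>2 * w\<^sup>2 / 3))"
    using assms by (intro mult_left_mono add_left_mono) auto
  then show ?thesis
    by (simp add: M_form_def algebra_simps power2_eq_square power3_eq_cube)
qed

lemma M_le_D_necessary:
  assumes "M_matrix e g \<preceq> D_matrix \<sigma> \<alpha>" and "0 < e"
  shows "e * (1 + (norm g)\<^sup>2) \<le> \<sigma>" and "e ^ 3 / 3 \<le> \<alpha>"
proof -
  have *: "M_form e g u w \<le> \<sigma> * (norm u)\<^sup>2 + \<alpha> * w\<^sup>2" for u w
    using assms(1) by (simp add: M_le_D_iff)
  show "e ^ 3 / 3 \<le> \<alpha>"
    using *[of 0 1] by (simp add: M_form_def power2_eq_square power3_eq_cube)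
  show "e * (1 + (norm g)\<^sup>2) \<le> \<sigma>"
  proof (cases "g = 0")
    case True
    then show ?thesis
      using *[of "axis 1 1" 0] by (simp add: M_form_def)
  next
    case False
    have "(e * (1 + (norm g)\<^sup>2)) * (norm g)\<^sup>2 \<le> \<sigma> * (norm g)\<^sup>2"
      using *[of g 0] by (simp add: M_form_def dot_square_norm algebra_simps power2_eq_square)
    then show ?thesis
      using False by (simp add: mult_le_cancel_right)
  qed
qed

lemma D_le_M_necessary:
  assumes "D_matrix \<sigma> \<alpha> \<preceq> \<gamma> *\<^sub>R M_matrix e g"
  shows "\<sigma> \<le> \<gamma> * e" and "\<alpha> \<le> \<gamma> * (e ^ 3 / 3)"
proof -
  have *: "\<sigma> * (norm u)\<^sup>2 + \<alpha> * w\<^sup>2 \<le> \<gamma> * M_form e g u w" for u w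
    using assms by (simp add: D_le_M_iff)
  show "\<alpha> \<le> \<gamma> * (e ^ 3 / 3)"
    using *[of 0 1] by (simp add: M_form_def power2_eq_square power3_eq_cube)
  show "\<sigma> \<le> \<gamma> * e"
  proof (cases "g = 0")
    case True
    then show ?thesis
      using *[of "axis 1 1" 0] by (simp add: M_form_def)
  next
    case False
    (* the rotation of g by a right angle, on which the rank-one part of M vanishes *)
    define u :: "real^2" where "u = vector [- g $ 2, g $ 1]"
    have u: "g \<bullet> u = 0" "(norm u)\<^sup>2 = (norm g)\<^sup>2"
      by (simp_all add: u_def inner_vec2 power2_norm_vec2)
    have "\<sigma> * (norm g)\<^sup>2 \<le> (\<gamma> * e) * (norm g)\<^sup>2"
      using *[of u 0] by (simp add: M_form_def u mult.assoc)
    then show ?thesis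
      using False by (simp add: mult_le_cancel_right)
  qed
qed

section \<open>Essential suprema on the domain\<close>

lemma region_not_null:
  assumes "admissible_dom \<Omega>"
  shows "emeasure (dom_measure \<Omega>) (space (dom_measure \<Omega>)) \<noteq> 0"
proof -
  obtain S where S: "open S" "S \<noteq> {}" "S \<subseteq> region \<Omega>" and meas: "region \<Omega> \<in> sets lebesgue"
  proof (cases \<Omega>)
    case (Planar U)
    with assms that[of U] show thesis
      by auto
  next
    case (Torus Lx Ly)
    have pos: "0 < Lx" "0 < Ly"
      using assms Torus by auto
    let ?S = "box 0 (vector [Lx, Ly] :: real^2)"
    have "(vector [Lx / 2, Ly / 2] :: real^2) \<in> ?S"
      using pos by (simp add: mem_box_cart forall_2)
    moreover have "?S \<subseteq> region \<Omega>"
      using Torus by (auto simp: mem_box_cart forall_2)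
    moreover have "region \<Omega> \<in> sets borel"
    proof -
      have "region \<Omega> = ({x. 0 \<le> x $ 1} \<inter> {x. x $ 1 < Lx}) \<inter> ({x. 0 \<le> x $ 2} \<inter> {x. x $ 2 < Ly})"
        using Torus by auto
      moreover have "closed {x :: real^2. 0 \<le> x $ i}" "open {x :: real^2. x $ i < c}" for i c
        by (intro closed_Collect_le open_Collect_less continuous_intros)+
      ultimately show ?thesis
        by (metis borel_closed borel_open sets.Int)
    qed
    ultimately show thesis
      using that[of ?S] by auto
  qed
  have "\<not> negligible (region \<Omega>)"
    using S open_not_negligible negligible_subset by blast
  then show ?thesis
    using meas by (simp add: emeasure_restrict_space space_restrict_space negligible_iff_null_sets null_sets_def)
qed

lemma AE_imp_ex_region:
  assumes "admissible_dom \<Omega>" and "AE x in dom_measure \<Omega>. P x"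
  obtains x where "P x"
proof -
  have "\<not> (AE x in dom_measure \<Omega>. False)"
    using region_not_null[OF assms(1)]
    by (simp only: ae_filter_eq_bot_iff[symmetric] trivial_limit_def not_False_eq_True)
  then have "\<exists>x. P x"
    using assms(2) by (metis (mono_tags, lifting) eventually_mono)
  then show thesis
    using that by blast
qed

text \<open>
  Positive measure and essential boundedness make the extended-real essential supremum finite, so
  that its real value has both properties of a least essential upper bound.
\<close>

lemma ess_max_properties:
  assumes "admissible_dom \<Omega>" and f: "f \<in> borel_measurable (dom_measure \<Omega>)"
    and C: "AE x in dom_measure \<Omega>. \<bar>f x\<bar> \<le> C"
  shows AE_le_ess_max: "AE x in dom_measure \<Omega>. f x \<le> ess_max \<Omega> f"
    and ess_max_least: "\<And>c. (AE x in dom_measure \<Omega>. f x \<le> c) \<Longrightarrow> ess_max \<Omega> f \<le> c"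
proof -
  let ?M = "dom_measure \<Omega>"
  let ?f = "\<lambda>x. ereal (f x)"
  have meas: "?f \<in> borel_measurable ?M"
    using f by simp
  have "esssup ?M ?f \<le> ereal C"
    using C by (intro esssup_I meas) (auto elim!: eventually_mono)
  moreover have "esssup ?M (\<lambda>x. ereal (- C)) \<le> esssup ?M ?f"
    using C by (intro esssup_AE_mono) (auto elim!: eventually_mono)
  ultimately have fin: "ereal (ess_max \<Omega> f) = esssup ?M ?f"
    unfolding ess_max_def esssup_const[OF region_not_null[OF assms(1)]]
    by (cases "esssup ?M ?f") auto
  show "AE x in ?M. f x \<le> ess_max \<Omega> f"
    using esssup_AE[of ?f ?M] unfolding fin[symmetric] by simp
  show "ess_max \<Omega> f \<le> c" if "AE x in ?M. f x \<le> c" for c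
  proof -
    have "esssup ?M ?f \<le> ereal c"
      using that by (intro esssup_I meas) simp
    then show ?thesis
      by (simp add: fin[symmetric])
  qed
qed

lemma ess_min_properties:
  assumes "admissible_dom \<Omega>" and f: "f \<in> borel_measurable (dom_measure \<Omega>)"
    and C: "AE x in dom_measure \<Omega>. \<bar>f x\<bar> \<le> C"
  shows AE_ess_min_le: "AE x in dom_measure \<Omega>. ess_min \<Omega> f \<le> f x"
    and ess_min_greatest: "\<And>c. (AE x in dom_measure \<Omega>. c \<le> f x) \<Longrightarrow> c \<le> ess_min \<Omega> f"
proof -
  have neg: "(\<lambda>x. - f x) \<in> borel_measurable (dom_measure \<Omega>)" "AE x in dom_measure \<Omega>. \<bar>- f x\<bar> \<le> C"
    using f C by simp_all
  show "AE x in dom_measure \<Omega>. ess_min \<Omega> f \<le> f x"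
    using AE_le_ess_max[OF assms(1) neg] by (simp add: ess_min_def minus_le_iff)
  show "c \<le> ess_min \<Omega> f" if "AE x in dom_measure \<Omega>. c \<le> f x" for c
    using ess_max_least[OF assms(1) neg, of "- c"] that by (simp add: ess_min_def)
qed

section \<open>Bounds on the optimal value\<close>

locale bathymetry =
  fixes \<Omega> :: dom and \<eta> :: "real^2 \<Rightarrow> real" and g :: "real^2 \<Rightarrow> real^2"
  assumes dom: "admissible_dom \<Omega>"
    and \<eta>: "\<eta> \<in> L_infinity \<Omega>"
    and g: "g \<in> L_infinity \<Omega>"
    and \<eta>_min_pos: "0 < ess_min \<Omega> \<eta>"
begin

abbreviation "\<eta>_min \<equiv> ess_min \<Omega> \<eta>"
abbreviation "\<eta>_max \<equiv> ess_max \<Omega> \<eta>"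
abbreviation "sigma_density x \<equiv> \<eta> x + 1 / 6 * (4 + sqrt 13) * \<eta> x * (norm (g x))\<^sup>2"

lemma \<eta>_measurable [measurable]: "\<eta> \<in> borel_measurable (dom_measure \<Omega>)"
  and g_measurable [measurable]: "g \<in> borel_measurable (dom_measure \<Omega>)"
  using \<eta> g by (auto simp: L_infinity_def)

lemma \<eta>_bounded: "\<exists>C. AE x in dom_measure \<Omega>. \<bar>\<eta> x\<bar> \<le> C"
  and g_bounded: "\<exists>C. AE x in dom_measure \<Omega>. \<bar>norm (g x)\<bar> \<le> C"
  using \<eta> g by (auto simp: L_infinity_def)

lemma AE_\<eta>: "AE x in dom_measure \<Omega>. \<eta>_min \<le> \<eta> x \<and> \<eta> x \<le> \<eta>_max"
proof -
  obtain C where C: "AE x in dom_measure \<Omega>. \<bar>\<eta> x\<bar> \<le> C"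
    using \<eta>_bounded by blast
  show ?thesis
    using AE_le_ess_max[OF dom \<eta>_measurable C] AE_ess_min_le[OF dom \<eta>_measurable C]
    by eventually_elim simp
qed

lemma \<eta>_max_least: "(AE x in dom_measure \<Omega>. \<eta> x \<le> c) \<Longrightarrow> \<eta>_max \<le> c"
  and \<eta>_min_greatest: "(AE x in dom_measure \<Omega>. c \<le> \<eta> x) \<Longrightarrow> c \<le> \<eta>_min"
  using \<eta>_bounded ess_max_least[OF dom \<eta>_measurable] ess_min_greatest[OF dom \<eta>_measurable] by auto

lemma \<eta>_min_le_max: "\<eta>_min \<le> \<eta>_max"
  using AE_imp_ex_region[OF dom AE_\<eta>] by force

lemma sigma_density_bounded: "\<exists>C. AE x in dom_measure \<Omega>. \<bar>sigma_density x\<bar> \<le> C"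
proof -
  obtain A B where A: "AE x in dom_measure \<Omega>. \<bar>\<eta> x\<bar> \<le> A" and B: "AE x in dom_measure \<Omega>. \<bar>norm (g x)\<bar> \<le> B"
    using \<eta>_bounded g_bounded by blast
  have "AE x in dom_measure \<Omega>. \<bar>sigma_density x\<bar> \<le> A * (1 + 1 / 6 * (4 + sqrt 13) * B\<^sup>2)"
    using A B
  proof eventually_elim
    fix x assume x: "\<bar>\<eta> x\<bar> \<le> A" "\<bar>norm (g x)\<bar> \<le> B"
    have "\<bar>sigma_density x\<bar> = \<bar>\<eta> x * (1 + 1 / 6 * (4 + sqrt 13) * (norm (g x))\<^sup>2)\<bar>"
      by (simp add: algebra_simps)
    also have "\<dots> = \<bar>\<eta> x\<bar> * (1 + 1 / 6 * (4 + sqrt 13) * (norm (g x))\<^sup>2)"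
      by (simp add: abs_mult)
    also have "\<dots> \<le> A * (1 + 1 / 6 * (4 + sqrt 13) * B\<^sup>2)"
      using x by (intro mult_mono add_left_mono mult_left_mono power_mono) auto
    finally show "\<bar>sigma_density x\<bar> \<le> A * (1 + 1 / 6 * (4 + sqrt 13) * B\<^sup>2)" .
  qed
  then show ?thesis ..
qed

lemma AE_sigma_density: "AE x in dom_measure \<Omega>. sigma_density x \<le> sigma_star \<Omega> \<eta> g"
  and sigma_star_least: "(AE x in dom_measure \<Omega>. sigma_density x \<le> c) \<Longrightarrow> sigma_star \<Omega> \<eta> g \<le> c"
proof -
  have "(\<lambda>x. sigma_density x) \<in> borel_measurable (dom_measure \<Omega>)"
    by measurable
  then show "AE x in dom_measure \<Omega>. sigma_density x \<le> sigma_star \<Omega> \<eta> g"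
    and "(AE x in dom_measure \<Omega>. sigma_density x \<le> c) \<Longrightarrow> sigma_star \<Omega> \<eta> g \<le> c"
    using sigma_density_bounded ess_max_properties[OF dom] unfolding sigma_star_def by blast+
qed

lemma ess_max_norm_eq_0_iff:
  "ess_max \<Omega> (\<lambda>x. norm (g x)) = 0 \<longleftrightarrow> (AE x in dom_measure \<Omega>. g x = 0)"
proof -
  have "(\<lambda>x. norm (g x)) \<in> borel_measurable (dom_measure \<Omega>)"
    by measurable
  then have ub: "AE x in dom_measure \<Omega>. norm (g x) \<le> ess_max \<Omega> (\<lambda>x. norm (g x))"
    and least: "\<And>c. (AE x in dom_measure \<Omega>. norm (g x) \<le> c) \<Longrightarrow> ess_max \<Omega> (\<lambda>x. norm (g x)) \<le> c"
    using g_bounded ess_max_properties[OF dom] by blast+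
  show ?thesis
  proof
    assume "ess_max \<Omega> (\<lambda>x. norm (g x)) = 0"
    with ub show "AE x in dom_measure \<Omega>. g x = 0"
      by simp
  next
    assume "AE x in dom_measure \<Omega>. g x = 0"
    then have "ess_max \<Omega> (\<lambda>x. norm (g x)) \<le> 0"
      by (intro least) simp
    moreover obtain x where "norm (g x) \<le> ess_max \<Omega> (\<lambda>x. norm (g x))"
      using AE_imp_ex_region[OF dom ub] .
    ultimately show "ess_max \<Omega> (\<lambda>x. norm (g x)) = 0"
      using norm_ge_zero[of "g x"] by linarith
  qed
qed

text \<open>
  The pointwise diagonal bounds on \<open>M\<close> have scalar entries \<open>a \<eta>^3\<close> above and \<open>b \<eta>^3\<close> below. A
  constant matrix has to dominate the upper bound where \<open>\<eta>\<close> is largest and be dominated by \<open>\<gamma>\<close>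
  times the lower one where \<open>\<eta>\<close> is smallest, which is where the ratio \<open>\<eta>_max / \<eta>_min\<close> comes from.
  Keeping \<open>a\<close> and \<open>b\<close> general covers the flat case (\<open>a = b = 1/3\<close>) and the general case (the two
  eigenvalues) at once.
\<close>

lemma feasible_if_form_bounds:
  assumes ab: "0 < a" "0 < b"
    and upper: "AE x in dom_measure \<Omega>. \<forall>u w. M_form (\<eta> x) (g x) u w \<le> \<sigma> * (norm u)\<^sup>2 + a * \<eta> x ^ 3 * w\<^sup>2"
    and lower: "AE x in dom_measure \<Omega>. \<forall>u w. \<eta> x * (norm u)\<^sup>2 + b * \<eta> x ^ 3 * w\<^sup>2 \<le> M_form (\<eta> x) (g x) u w"
    and \<gamma>1: "\<sigma> / \<eta>_min \<le> \<gamma>" and \<gamma>2: "a / b * (\<eta>_max / \<eta>_min) ^ 3 \<le> \<gamma>"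
  shows "(\<sigma>, a * \<eta>_max ^ 3, \<gamma>) \<in> feasible_P \<Omega> \<eta> g"
  unfolding feasible_P_def mem_Collect_eq prod.case
  using AE_\<eta> upper lower
proof eventually_elim
  fix x
  assume x: "\<eta>_min \<le> \<eta> x \<and> \<eta> x \<le> \<eta>_max"
    and up: "\<forall>u w. M_form (\<eta> x) (g x) u w \<le> \<sigma> * (norm u)\<^sup>2 + a * \<eta> x ^ 3 * w\<^sup>2"
    and lo: "\<forall>u w. \<eta> x * (norm u)\<^sup>2 + b * \<eta> x ^ 3 * w\<^sup>2 \<le> M_form (\<eta> x) (g x) u w"
  have cubes: "\<eta>_min ^ 3 \<le> \<eta> x ^ 3" "\<eta> x ^ 3 \<le> \<eta>_max ^ 3"
    using x \<eta>_min_pos by (auto intro: power_mono)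
  have "0 \<le> a / b * (\<eta>_max / \<eta>_min) ^ 3"
    using ab x \<eta>_min_pos by simp
  with \<gamma>2 have \<gamma>0: "0 \<le> \<gamma>"
    by simp
  have "\<sigma> \<le> \<gamma> * \<eta>_min"
    using \<gamma>1 \<eta>_min_pos by (simp add: pos_divide_le_eq)
  also have "\<dots> \<le> \<gamma> * \<eta> x"
    using x \<gamma>0 by (intro mult_left_mono) auto
  finally have \<sigma>: "\<sigma> \<le> \<gamma> * \<eta> x" .
  have "a * \<eta>_max ^ 3 \<le> \<gamma> * (b * \<eta>_min ^ 3)"
    using \<gamma>2 ab \<eta>_min_pos by (simp add: power_divide field_simps)
  also have "\<dots> \<le> \<gamma> * (b * \<eta> x ^ 3)"
    using cubes ab \<gamma>0 by (intro mult_left_mono) auto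
  finally have \<alpha>: "a * \<eta>_max ^ 3 \<le> \<gamma> * (b * \<eta> x ^ 3)" .
  have "M_form (\<eta> x) (g x) u w \<le> \<sigma> * (norm u)\<^sup>2 + a * \<eta>_max ^ 3 * w\<^sup>2" for u w
  proof -
    have "a * \<eta> x ^ 3 * w\<^sup>2 \<le> a * \<eta>_max ^ 3 * w\<^sup>2"
      using cubes ab by (intro mult_right_mono mult_left_mono) auto
    with up show ?thesis
      by (meson add_left_mono order_trans)
  qed
  moreover have "\<sigma> * (norm u)\<^sup>2 + a * \<eta>_max ^ 3 * w\<^sup>2 \<le> \<gamma> * M_form (\<eta> x) (g x) u w" for u w
  proof -
    have "\<sigma> * (norm u)\<^sup>2 + a * \<eta>_max ^ 3 * w\<^sup>2 \<le> (\<gamma> * \<eta> x) * (norm u)\<^sup>2 + (\<gamma> * (b * \<eta> x ^ 3)) * w\<^sup>2"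
      by (intro add_mono mult_right_mono \<sigma> \<alpha>) auto
    also have "\<dots> = \<gamma> * (\<eta> x * (norm u)\<^sup>2 + b * \<eta> x ^ 3 * w\<^sup>2)"
      by (simp add: algebra_simps)
    also have "\<dots> \<le> \<gamma> * M_form (\<eta> x) (g x) u w"
      using lo \<gamma>0 by (intro mult_left_mono) auto
    finally show ?thesis .
  qed
  ultimately show "M_matrix (\<eta> x) (g x) \<preceq> D_matrix \<sigma> (a * \<eta>_max ^ 3)
      \<and> D_matrix \<sigma> (a * \<eta>_max ^ 3) \<preceq> \<gamma> *\<^sub>R M_matrix (\<eta> x) (g x)"
    by (simp add: M_le_D_iff D_le_M_iff)
qed

lemma kappa_ub_feasible: "\<exists>\<sigma> \<alpha>. (\<sigma>, \<alpha>, kappa_ub \<Omega> \<eta> g) \<in> feasible_P \<Omega> \<eta> g"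
proof (cases "ess_max \<Omega> (\<lambda>x. norm (g x)) = 0")
  case True
  then have flat: "AE x in dom_measure \<Omega>. g x = 0"
    by (simp add: ess_max_norm_eq_0_iff)
  have form: "M_form e 0 u w = e * (norm u)\<^sup>2 + 1 / 3 * e ^ 3 * w\<^sup>2" for e u w
    by (simp add: M_form_def algebra_simps power2_eq_square power3_eq_cube)
  (* the scalar block alone determines the value, since the depth ratio is at least 1 *)
  have "\<eta>_max / \<eta>_min \<le> (\<eta>_max / \<eta>_min) ^ 3"
    using \<eta>_min_le_max \<eta>_min_pos by (intro self_le_power) auto
  then have "(\<eta>_max, 1 / 3 * \<eta>_max ^ 3, (\<eta>_max / \<eta>_min) ^ 3) \<in> feasible_P \<Omega> \<eta> g"
  proof (intro feasible_if_form_bounds[where b = "1 / 3"])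
    show "AE x in dom_measure \<Omega>. \<forall>u w. M_form (\<eta> x) (g x) u w \<le> \<eta>_max * (norm u)\<^sup>2 + 1 / 3 * \<eta> x ^ 3 * w\<^sup>2"
      using flat AE_\<eta> by eventually_elim (auto simp: form intro: mult_right_mono)
    show "AE x in dom_measure \<Omega>. \<forall>u w. \<eta> x * (norm u)\<^sup>2 + 1 / 3 * \<eta> x ^ 3 * w\<^sup>2 \<le> M_form (\<eta> x) (g x) u w"
      using flat by eventually_elim (simp add: form)
  qed auto
  with True show ?thesis
    by (auto simp: kappa_ub_def)
next
  case False
  let ?a = "(4 + sqrt 13) / 6" and ?b = "(4 - sqrt 13) / 6"
  have pos: "AE x in dom_measure \<Omega>. 0 < \<eta> x"
    using AE_\<eta> by eventually_elim (use \<eta>_min_pos in linarith)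
  have "?a / ?b = (4 + sqrt 13) / (4 - sqrt 13)"
    by (simp only: divide_divide_times_eq) (simp only: mult.commute[of _ 6] mult_divide_mult_cancel_left_if, simp)
  then have "(sigma_star \<Omega> \<eta> g, ?a * \<eta>_max ^ 3, kappa_ub \<Omega> \<eta> g) \<in> feasible_P \<Omega> \<eta> g"
  proof (intro feasible_if_form_bounds[where b = ?b])
    show "AE x in dom_measure \<Omega>. \<forall>u w. M_form (\<eta> x) (g x) u w
        \<le> sigma_star \<Omega> \<eta> g * (norm u)\<^sup>2 + ?a * \<eta> x ^ 3 * w\<^sup>2"
      using pos AE_sigma_density
    proof (eventually_elim, intro allI)
      fix x u w assume x: "0 < \<eta> x" "sigma_density x \<le> sigma_star \<Omega> \<eta> g"
      have "M_form (\<eta> x) (g x) u w \<le> sigma_density x * (norm u)\<^sup>2 + ?a * \<eta> x ^ 3 * w\<^sup>2"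
        using x(1) by (rule M_form_upper)
      also have "\<dots> \<le> sigma_star \<Omega> \<eta> g * (norm u)\<^sup>2 + ?a * \<eta> x ^ 3 * w\<^sup>2"
        using x(2) by (intro add_right_mono mult_right_mono) auto
      finally show "M_form (\<eta> x) (g x) u w \<le> sigma_star \<Omega> \<eta> g * (norm u)\<^sup>2 + ?a * \<eta> x ^ 3 * w\<^sup>2" .
    qed
    show "AE x in dom_measure \<Omega>. \<forall>u w. \<eta> x * (norm u)\<^sup>2 + ?b * \<eta> x ^ 3 * w\<^sup>2 \<le> M_form (\<eta> x) (g x) u w"
      using pos by eventually_elim (intro allI M_form_lower)
    show "0 < ?a"
      by (simp add: add_pos_pos)
    show "0 < ?b"
      using sqrt13_bounds by simp
  qed (use False in \<open>auto simp: kappa_ub_def\<close>)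
  then show ?thesis
    by blast
qed

lemma feasible_lower_bounds:
  assumes "(\<sigma>, \<alpha>, \<gamma>) \<in> feasible_P \<Omega> \<eta> g"
  shows "1 \<le> \<gamma>"
    and "\<sigma> \<le> \<gamma> * \<eta>_min"
    and "AE x in dom_measure \<Omega>. 0 < \<eta> x \<and> \<eta> x * (1 + (norm (g x))\<^sup>2) \<le> \<sigma>"
    and "(\<eta>_max / \<eta>_min) ^ 3 \<le> \<gamma>"
proof -
  have "AE x in dom_measure \<Omega>. M_matrix (\<eta> x) (g x) \<preceq> D_matrix \<sigma> \<alpha>
      \<and> D_matrix \<sigma> \<alpha> \<preceq> \<gamma> *\<^sub>R M_matrix (\<eta> x) (g x)"
    using assms by (simp add: feasible_P_def)
  with AE_\<eta> have bounds: "AE x in dom_measure \<Omega>. 0 < \<eta> x \<and> \<eta> x * (1 + (norm (g x))\<^sup>2) \<le> \<sigma>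
      \<and> \<eta> x ^ 3 / 3 \<le> \<alpha> \<and> \<sigma> \<le> \<gamma> * \<eta> x \<and> \<alpha> \<le> \<gamma> * (\<eta> x ^ 3 / 3)"
  proof eventually_elim
    fix x assume x: "\<eta>_min \<le> \<eta> x \<and> \<eta> x \<le> \<eta>_max"
      "M_matrix (\<eta> x) (g x) \<preceq> D_matrix \<sigma> \<alpha> \<and> D_matrix \<sigma> \<alpha> \<preceq> \<gamma> *\<^sub>R M_matrix (\<eta> x) (g x)"
    then have "0 < \<eta> x"
      using \<eta>_min_pos by linarith
    with x(2) show "0 < \<eta> x \<and> \<eta> x * (1 + (norm (g x))\<^sup>2) \<le> \<sigma>
      \<and> \<eta> x ^ 3 / 3 \<le> \<alpha> \<and> \<sigma> \<le> \<gamma> * \<eta> x \<and> \<alpha> \<le> \<gamma> * (\<eta> x ^ 3 / 3)"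
      using M_le_D_necessary D_le_M_necessary by blast
  qed
  then show "AE x in dom_measure \<Omega>. 0 < \<eta> x \<and> \<eta> x * (1 + (norm (g x))\<^sup>2) \<le> \<sigma>"
    by eventually_elim simp
  obtain x where x: "0 < \<eta> x" "\<eta> x ^ 3 / 3 \<le> \<alpha>" "\<alpha> \<le> \<gamma> * (\<eta> x ^ 3 / 3)"
    using AE_imp_ex_region[OF dom bounds] by blast
  then have "1 * (\<eta> x ^ 3 / 3) \<le> \<gamma> * (\<eta> x ^ 3 / 3)"
    by linarith
  with x(1) show \<gamma>: "1 \<le> \<gamma>"
    by (simp add: mult_le_cancel_right)
  have "\<sigma> / \<gamma> \<le> \<eta>_min"
    using bounds \<gamma> by (intro \<eta>_min_greatest) (auto elim!: eventually_mono simp: field_simps)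
  then show "\<sigma> \<le> \<gamma> * \<eta>_min"
    using \<gamma> by (simp add: field_simps)
  (* cube roots turn the bounds on the cube of the depth into bounds on the depth *)
  have cube_root: "root 3 (t ^ 3) = t" "root 3 t ^ 3 = t" for t :: real
    by (simp_all add: odd_real_root_power_cancel odd_real_root_pow)
  have "\<eta>_max \<le> root 3 (3 * \<alpha>)"
  proof (intro \<eta>_max_least)
    show "AE x in dom_measure \<Omega>. \<eta> x \<le> root 3 (3 * \<alpha>)"
      using bounds
    proof eventually_elim
      case (elim x)
      then have "root 3 (\<eta> x ^ 3) \<le> root 3 (3 * \<alpha>)"
        by simp
      then show ?case
        by (simp only: cube_root)
    qed
  qed
  then have "\<eta>_max ^ 3 \<le> root 3 (3 * \<alpha>) ^ 3"
    using \<eta>_min_pos \<eta>_min_le_max by (intro power_mono) auto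
  then have max: "\<eta>_max ^ 3 \<le> 3 * \<alpha>"
    by (simp only: cube_root)
  have "0 \<le> \<alpha>"
    using max \<eta>_min_pos \<eta>_min_le_max zero_le_power[of \<eta>_max 3] by linarith
  have "root 3 (3 * \<alpha> / \<gamma>) \<le> \<eta>_min"
  proof (intro \<eta>_min_greatest)
    show "AE x in dom_measure \<Omega>. root 3 (3 * \<alpha> / \<gamma>) \<le> \<eta> x"
      using bounds
    proof eventually_elim
      case (elim x)
      then have "root 3 (3 * \<alpha> / \<gamma>) \<le> root 3 (\<eta> x ^ 3)"
        using \<gamma> by (simp add: field_simps)
      then show ?case
        by (simp only: cube_root)
    qed
  qed
  then have "root 3 (3 * \<alpha> / \<gamma>) ^ 3 \<le> \<eta>_min ^ 3"
    using \<gamma> \<open>0 \<le> \<alpha>\<close> by (intro power_mono) auto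
  then have "3 * \<alpha> / \<gamma> \<le> \<eta>_min ^ 3"
    by (simp only: cube_root)
  then have "3 * \<alpha> \<le> \<gamma> * \<eta>_min ^ 3"
    using \<gamma> by (simp add: field_simps)
  with max show "(\<eta>_max / \<eta>_min) ^ 3 \<le> \<gamma>"
    using \<eta>_min_pos by (simp add: power_divide pos_divide_le_eq)
qed

lemma kappa_ub_le_feasible_flat:
  assumes "AE x in dom_measure \<Omega>. g x = 0" and "(\<sigma>, \<alpha>, \<gamma>) \<in> feasible_P \<Omega> \<eta> g"
  shows "kappa_ub \<Omega> \<eta> g \<le> \<gamma>"
  using assms feasible_lower_bounds(4) by (simp add: kappa_ub_def ess_max_norm_eq_0_iff)

text \<open>
  The larger eigenvalue \<open>(4 + sqrt 13)/6\<close> lies between 1 and the ratio of the eigenvalues, so the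
  weight of \<open>|g|\<^sup>2\<close> in \<open>sigma_star\<close> costs at most that ratio compared with \<open>\<eta> (1 + |g|\<^sup>2) \<le> \<sigma>\<close>.
\<close>

lemma kappa_ub_le_feasible:
  assumes "(\<sigma>, \<alpha>, \<gamma>) \<in> feasible_P \<Omega> \<eta> g"
  shows "kappa_ub \<Omega> \<eta> g \<le> (4 + sqrt 13) / (4 - sqrt 13) * \<gamma>"
proof -
  let ?a = "(4 + sqrt 13) / 6" and ?C = "(4 + sqrt 13) / (4 - sqrt 13)"
  note lb = feasible_lower_bounds[OF assms]
  have const: "1 \<le> ?a" "?a \<le> ?C"
    using sqrt13_bounds by (simp, intro divide_left_mono mult_pos_pos) linarith+
  have "0 \<le> ?a * \<gamma>"
    using lb(1) const by simp
  have flat: "(\<eta>_max / \<eta>_min) ^ 3 \<le> ?C * \<gamma>"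
  proof -
    have "1 * \<gamma> \<le> ?C * \<gamma>"
      using const lb(1) by (intro mult_right_mono) linarith+
    with lb(4) show ?thesis
      by linarith
  qed
  have "sigma_star \<Omega> \<eta> g \<le> ?a * \<sigma>"
  proof (intro sigma_star_least)
    show "AE x in dom_measure \<Omega>. sigma_density x \<le> ?a * \<sigma>"
      using lb(3)
    proof eventually_elim
      fix x assume x: "0 < \<eta> x \<and> \<eta> x * (1 + (norm (g x))\<^sup>2) \<le> \<sigma>"
      have "sigma_density x = 1 * \<eta> x + ?a * (\<eta> x * (norm (g x))\<^sup>2)"
        by simp
      also have "\<dots> \<le> ?a * \<eta> x + ?a * (\<eta> x * (norm (g x))\<^sup>2)"
        using const x by (intro add_right_mono mult_right_mono) auto
      also have "\<dots> = ?a * (\<eta> x * (1 + (norm (g x))\<^sup>2))"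
        by (simp only: distrib_left mult_1_right)
      also have "\<dots> \<le> ?a * \<sigma>"
        using x const by (intro mult_left_mono) auto
      finally show "sigma_density x \<le> ?a * \<sigma>" .
    qed
  qed
  also have "\<dots> \<le> ?a * (\<gamma> * \<eta>_min)"
    using lb(2) const by (intro mult_left_mono) auto
  also have "\<dots> \<le> ?C * (\<gamma> * \<eta>_min)"
    using const lb(1) \<eta>_min_pos by (intro mult_right_mono) auto
  finally have "sigma_star \<Omega> \<eta> g / \<eta>_min \<le> ?C * \<gamma>"
    using \<eta>_min_pos by (simp only: pos_divide_le_eq mult.assoc)
  moreover have "?C * (\<eta>_max / \<eta>_min) ^ 3 \<le> ?C * \<gamma>"
    using lb(4) const by (intro mult_left_mono) linarith+
  ultimately show ?thesis
    using flat unfolding kappa_ub_def by (simp only: max.bounded_iff split: if_split) blast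
qed

end

theorem theoremB1:
  fixes \<Omega> :: dom
    and \<eta> h :: "real^2 \<Rightarrow> real"
    and grad_h :: "real^2 \<Rightarrow> real^2"
  assumes "admissible_dom \<Omega>"
    and "has_weak_gradient \<Omega> h grad_h"
    and "\<eta> \<in> L_infinity \<Omega>"
    and "grad_h \<in> L_infinity \<Omega>"
    and "0 < ess_min \<Omega> \<eta>"
  shows "gamma_P \<Omega> \<eta> grad_h \<le> ereal (kappa_ub \<Omega> \<eta> grad_h)
    \<and> ereal (kappa_ub \<Omega> \<eta> grad_h) \<le> ereal ((4 + sqrt 13) / (4 - sqrt 13)) * gamma_P \<Omega> \<eta> grad_h
    \<and> ((AE x in dom_measure \<Omega>. grad_h x = 0) \<longrightarrow>
         ereal (kappa_ub \<Omega> \<eta> grad_h) = gamma_P \<Omega> \<eta> grad_h)"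
proof -
  interpret bathymetry \<Omega> \<eta> grad_h
    using assms by unfold_locales
  let ?C = "(4 + sqrt 13) / (4 - sqrt 13)" and ?\<kappa> = "kappa_ub \<Omega> \<eta> grad_h"
  have C: "0 < ?C"
    using sqrt13_bounds by (intro divide_pos_pos) linarith+
  have upper: "gamma_P \<Omega> \<eta> grad_h \<le> ereal ?\<kappa>"
    using kappa_ub_feasible unfolding gamma_P_def by (force intro: INF_lower2)
  have "ereal (?\<kappa> / ?C) \<le> gamma_P \<Omega> \<eta> grad_h"
    unfolding gamma_P_def
  proof (intro INF_greatest, clarify)
    fix \<sigma> \<alpha> \<gamma> assume "(\<sigma>, \<alpha>, \<gamma>) \<in> feasible_P \<Omega> \<eta> grad_h"
    then have "?\<kappa> \<le> ?C * \<gamma>"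
      by (rule kappa_ub_le_feasible)
    then show "ereal (?\<kappa> / ?C) \<le> ereal \<gamma>"
      using C by (simp only: ereal_less_eq pos_divide_le_eq mult.commute)
  qed
  then have "ereal ?C * ereal (?\<kappa> / ?C) \<le> ereal ?C * gamma_P \<Omega> \<eta> grad_h"
    using C by (intro ereal_mult_left_mono) auto
  moreover have "ereal ?C * ereal (?\<kappa> / ?C) = ereal ?\<kappa>"
    using C by (simp only: times_ereal.simps nonzero_mult_div_cancel_left times_divide_eq_right less_imp_neq[symmetric] not_False_eq_True)
  moreover have "ereal ?\<kappa> = gamma_P \<Omega> \<eta> grad_h" if "AE x in dom_measure \<Omega>. grad_h x = 0"
  proof (rule antisym[OF _ upper])
    show "ereal ?\<kappa> \<le> gamma_P \<Omega> \<eta> grad_h"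
      unfolding gamma_P_def using kappa_ub_le_feasible_flat[OF that]
      by (intro INF_greatest) auto
  qed
  ultimately show ?thesis
    using upper by metis
qed

end
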